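(* Let $\Gamma_n=\{P_1,\ldots,P_k\}$ with $k\ge 2$ and let $Q$ be a minimal witness of $\Gamma_n$. Then $|Q|\le n(k-1)+1$.
   Context: $\Gamma_n$ is a set of $k$ pairwise non-isomorphic (unlabelled) posets each of size $n$. A downset is a downward-closed subset; $D_n(Q)$ is the set of downsets of $Q$ of size $n$ up to isomorphism. $Q$ is a witness of $\Gamma_n$ if $D_n(Q)=\Gamma_n$, and a minimal witness if no proper downset of $Q$ is a witness of $\Gamma_n$. *)

theory Defs
  imports Main
begin

type_synonym 'a poset = "'a set \<times> ('a \<Rightarrow> 'a \<Rightarrow> bool)"

definition is_poset :: "'a poset \<Rightarrow> bool" where
  "is_poset P \<longleftrightarrow> finite (fst P) \<and>
     (\<forall>x\<in>fst P. snd P x x) \<and>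
     (\<forall>x\<in>fst P. \<forall>y\<in>fst P. snd P x y \<and> snd P y x \<longrightarrow> x = y) \<and>
     (\<forall>x\<in>fst P. \<forall>y\<in>fst P. \<forall>z\<in>fst P. snd P x y \<and> snd P y z \<longrightarrow> snd P x z)"

definition poset_iso :: "'a poset \<Rightarrow> 'b poset \<Rightarrow> bool" where
  "poset_iso P R \<longleftrightarrow> (\<exists>f. bij_betw f (fst P) (fst R) \<and>
     (\<forall>x\<in>fst P. \<forall>y\<in>fst P. snd P x y \<longleftrightarrow> snd R (f x) (f y)))"

definition is_downset :: "'a poset \<Rightarrow> 'a set \<Rightarrow> bool" where
  "is_downset P D \<longleftrightarrow> D \<subseteq> fst P \<and> (\<forall>x\<in>D. \<forall>y\<in>fst P. snd P y x \<longrightarrow> y \<in> D)"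

definition subposet :: "'a poset \<Rightarrow> 'a set \<Rightarrow> 'a poset" where
  "subposet P D = (D, snd P)"

definition is_witness :: "nat \<Rightarrow> 'b poset set \<Rightarrow> 'a poset \<Rightarrow> bool" where
  "is_witness n \<Gamma> Q \<longleftrightarrow>
     (\<forall>D. is_downset Q D \<and> card D = n \<longrightarrow> (\<exists>P\<in>\<Gamma>. poset_iso (subposet Q D) P)) \<and>
     (\<forall>P\<in>\<Gamma>. \<exists>D. is_downset Q D \<and> card D = n \<and> poset_iso (subposet Q D) P)"

definition is_minimal_witness :: "nat \<Rightarrow> 'b poset set \<Rightarrow> 'a poset \<Rightarrow> bool" where
  "is_minimal_witness n \<Gamma> Q \<longleftrightarrow> is_witness n \<Gamma> Q \<and>
     (\<forall>D. is_downset Q D \<and> D \<noteq> fst Q \<longrightarrow> \<not> is_witness n \<Gamma> (subposet Q D))"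

end

theory Submission
  imports Defs
begin

(* Any two downsets of size n are joined by a chain of size-n downsets in which consecutive
   members differ in a single element: trade a maximal element of one that the other lacks
   for a minimal element of the other that the first lacks.  Along such a chain between
   realisations of two different members of \<Gamma> the isomorphism type must change, which gives
   non-isomorphic size-n downsets D, D' with |D \<union> D'| \<le> n + 1.  Adding one realising downset
   for each of the other k - 2 members of \<Gamma> yields a downset that is still a witness; by
   minimality it is all of Q, so |Q| \<le> n + 1 + n (k - 2). *)

lemma is_poset_strict_asymp_transp:
  assumes "is_poset Q" and "S \<subseteq> fst Q"
  shows "asymp_on S (\<lambda>x y. snd Q x y \<and> x \<noteq> y)" and "transp_on S (\<lambda>x y. snd Q x y \<and> x \<noteq> y)"
  using assms unfolding is_poset_def asymp_on_def transp_on_def by blast+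

lemma poset_iso_sym:
  assumes "poset_iso P R"
  shows "poset_iso R P"
proof -
  obtain f where f: "bij_betw f (fst P) (fst R)"
    and f_iff: "\<forall>x\<in>fst P. \<forall>y\<in>fst P. snd P x y \<longleftrightarrow> snd R (f x) (f y)"
    using assms unfolding poset_iso_def by blast
  define g where "g = the_inv_into (fst P) f"
  have g: "bij_betw g (fst R) (fst P)"
    unfolding g_def using f by (rule bij_betw_the_inv_into)
  have f_g: "f (g x) = x" if "x \<in> fst R" for x
    unfolding g_def using f that by (metis f_the_inv_into_f_bij_betw)
  have "\<forall>x\<in>fst R. \<forall>y\<in>fst R. snd R x y \<longleftrightarrow> snd P (g x) (g y)"
    using f_iff f_g g by (metis bij_betwE)
  with g show ?thesis
    unfolding poset_iso_def by blast
qed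

lemma poset_iso_trans:
  assumes "poset_iso P R" and "poset_iso R S"
  shows "poset_iso P S"
proof -
  obtain f where f: "bij_betw f (fst P) (fst R)"
    and f_iff: "\<forall>x\<in>fst P. \<forall>y\<in>fst P. snd P x y \<longleftrightarrow> snd R (f x) (f y)"
    using assms(1) unfolding poset_iso_def by blast
  obtain g where g: "bij_betw g (fst R) (fst S)"
    and g_iff: "\<forall>x\<in>fst R. \<forall>y\<in>fst R. snd R x y \<longleftrightarrow> snd S (g x) (g y)"
    using assms(2) unfolding poset_iso_def by blast
  have "bij_betw (g \<circ> f) (fst P) (fst S)"
    using f g by (rule bij_betw_trans)
  moreover have "\<forall>x\<in>fst P. \<forall>y\<in>fst P. snd P x y \<longleftrightarrow> snd S ((g \<circ> f) x) ((g \<circ> f) y)"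
    using f_iff g_iff f by (simp add: bij_betwE)
  ultimately show ?thesis
    unfolding poset_iso_def by blast
qed

lemma poset_iso_iff_same_representative:
  assumes "\<forall>P\<in>\<Gamma>. \<forall>P'\<in>\<Gamma>. poset_iso P P' \<longrightarrow> P = P'" and "P \<in> \<Gamma>" and "P' \<in> \<Gamma>"
    and A: "poset_iso A P" and B: "poset_iso B P'"
  shows "poset_iso A B \<longleftrightarrow> P = P'"
proof
  assume "poset_iso A B"
  then have "poset_iso P P'"
    using poset_iso_trans[OF poset_iso_trans[OF poset_iso_sym[OF A]] B] by blast
  with assms(1-3) show "P = P'"
    by blast
next
  assume "P = P'"
  with A B show "poset_iso A B"
    using poset_iso_trans[OF _ poset_iso_sym] by blast
qed

lemma is_downset_insert:
  assumes "is_downset Q D" and "x \<in> fst Q"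
    and "\<forall>y\<in>fst Q. snd Q y x \<longrightarrow> y = x \<or> y \<in> D"
  shows "is_downset Q (insert x D)"
  using assms unfolding is_downset_def by blast

lemma is_downset_Diff_maximal:
  assumes "is_downset Q D" and "\<forall>w\<in>D. snd Q z w \<longrightarrow> w = z"
  shows "is_downset Q (D - {z})"
  using assms unfolding is_downset_def by blast

lemma is_downset_Un:
  assumes "is_downset Q A" and "is_downset Q B"
  shows "is_downset Q (A \<union> B)"
  using assms unfolding is_downset_def by blast

lemma is_downset_UN:
  assumes "\<forall>i\<in>I. is_downset Q (A i)"
  shows "is_downset Q (\<Union>i\<in>I. A i)"
  using assms unfolding is_downset_def by blast

lemma is_downset_exchange:
  assumes D: "is_downset Q D" and D': "is_downset Q D'" and x: "x \<in> D - D'" and z: "z \<in> D' - D"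
    and x_min: "\<forall>y\<in>D - D'. snd Q y x \<longrightarrow> y = x" and z_max: "\<forall>y\<in>D' - D. snd Q z y \<longrightarrow> y = z"
  shows "is_downset Q (insert x (D' - {z}))"
proof (rule is_downset_insert)
  have "\<forall>w\<in>D'. snd Q z w \<longrightarrow> w = z"
  proof (intro ballI impI)
    fix w
    assume "w \<in> D'" and "snd Q z w"
    moreover have "w \<notin> D"
      using D D' z \<open>snd Q z w\<close> unfolding is_downset_def by blast
    ultimately show "w = z"
      using z_max by blast
  qed
  with D' show "is_downset Q (D' - {z})"
    by (rule is_downset_Diff_maximal)
  show "x \<in> fst Q"
    using D x unfolding is_downset_def by blast
  show "\<forall>y\<in>fst Q. snd Q y x \<longrightarrow> y = x \<or> y \<in> D' - {z}"
  proof (intro ballI impI)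
    fix y
    assume "y \<in> fst Q" and "snd Q y x"
    then have "y \<in> D"
      using D x unfolding is_downset_def by blast
    then show "y = x \<or> y \<in> D' - {z}"
      using x_min \<open>snd Q y x\<close> z by blast
  qed
qed

lemma downset_exchange:
  assumes Q: "is_poset Q" and D: "is_downset Q D" and D': "is_downset Q D'"
    and card_D: "card D = n" and card_D': "card D' = n" and far: "card (D \<inter> D') + 2 \<le> n"
  obtains E where "is_downset Q E" and "card E = n"
    and "card (D \<inter> D') < card (E \<inter> D)" and "card (D \<inter> D') < card (E \<inter> D')"
proof -
  have sub: "D - D' \<subseteq> fst Q" "D' - D \<subseteq> fst Q"
    using D D' unfolding is_downset_def by auto
  have fin: "finite D" "finite D'"
    using Q D D' unfolding is_poset_def is_downset_def by (auto intro: finite_subset)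
  have "card (D \<inter> D') < card D" and "card (D \<inter> D') < card D'"
    using far card_D card_D' by linarith+
  then have "\<not> D \<subseteq> D'" and "\<not> D' \<subseteq> D"
    by (auto simp: Int_absorb1 Int_absorb2)
  then have ne: "D - D' \<noteq> {}" "D' - D \<noteq> {}"
    by blast+
  have fin_Diff: "finite (D - D')" "finite (D' - D)"
    using fin by blast+
  obtain x where x: "x \<in> D - D'" "\<forall>y\<in>D - D'. snd Q y x \<longrightarrow> y = x"
    using Finite_Set.bex_min_element[OF fin_Diff(1) is_poset_strict_asymp_transp[OF Q sub(1)] ne(1)]
    by blast
  obtain z where z: "z \<in> D' - D" "\<forall>y\<in>D' - D. snd Q z y \<longrightarrow> y = z"
    using Finite_Set.bex_max_element[OF fin_Diff(2) is_poset_strict_asymp_transp[OF Q sub(2)] ne(2)]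
    by blast
  let ?E = "insert x (D' - {z})"
  have "card ?E = n"
    using x z card_D' far fin by (simp add: card_Diff_singleton)
  moreover have "card (D \<inter> D') < card (?E \<inter> D)"
  proof -
    have "card (insert x (D \<inter> D')) \<le> card (?E \<inter> D)"
      using fin x z by (intro card_mono) auto
    moreover have "card (insert x (D \<inter> D')) = Suc (card (D \<inter> D'))"
      using fin x by simp
    ultimately show ?thesis
      by simp
  qed
  moreover have "card (D \<inter> D') < card (?E \<inter> D')"
  proof -
    have "?E \<inter> D' = D' - {z}"
      using x by blast
    then show ?thesis
      using z card_D' far by simp
  qed
  ultimately show ?thesis
    using that is_downset_exchange[OF D D' x(1) z(1) x(2) z(2)] by blast
qed

lemma exists_adjacent_nonisomorphic_downsets:
  assumes Q: "is_poset Q" and "is_downset Q D" and "is_downset Q D'"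
    and "card D = n" and "card D' = n" and "\<not> poset_iso (subposet Q D) (subposet Q D')"
  obtains E E' where "is_downset Q E" and "is_downset Q E'" and "card E = n" and "card E' = n"
    and "\<not> poset_iso (subposet Q E) (subposet Q E')" and "card (E \<union> E') \<le> n + 1"
proof -
  have "\<exists>E E'. is_downset Q E \<and> is_downset Q E' \<and> card E = n \<and> card E' = n
      \<and> \<not> poset_iso (subposet Q E) (subposet Q E') \<and> n \<le> card (E \<inter> E') + 1"
    using assms(2-6)
  proof (induction "n - card (D \<inter> D')" arbitrary: D D' rule: less_induct)
    case less
    show ?case
    proof (cases "n \<le> card (D \<inter> D') + 1")
      case True
      then show ?thesis
        using less.prems by blast
    next
      case False
      then obtain E where E: "is_downset Q E" "card E = n"
        and closer: "card (D \<inter> D') < card (E \<inter> D)" "card (D \<inter> D') < card (E \<inter> D')"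
        using downset_exchange[OF Q less.prems(1-4)] by auto
      have "finite E"
        using E(1) Q unfolding is_downset_def is_poset_def by (auto intro: finite_subset)
      then have "card (E \<inter> D) \<le> n" "card (E \<inter> D') \<le> n"
        using E(2) by (auto intro: card_mono)
      then have shorter: "n - card (E \<inter> D) < n - card (D \<inter> D')" "n - card (E \<inter> D') < n - card (D \<inter> D')"
        using closer by linarith+
      show ?thesis
      proof (cases "poset_iso (subposet Q E) (subposet Q D)")
        case False
        then show ?thesis
          using less.hyps[OF shorter(1) E(1) less.prems(1) E(2) less.prems(3)] by blast
      next
        case True
        then have "\<not> poset_iso (subposet Q E) (subposet Q D')"
          using less.prems(5) poset_iso_trans[OF poset_iso_sym] by blast
        then show ?thesis
          using less.hyps[OF shorter(2) E(1) less.prems(2) E(2) less.prems(4)] by blast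
      qed
    qed
  qed
  then obtain E E' where EE': "is_downset Q E" "is_downset Q E'" "card E = n" "card E' = n"
      "\<not> poset_iso (subposet Q E) (subposet Q E')" "n \<le> card (E \<inter> E') + 1"
    by blast
  moreover have "finite E" "finite E'"
    using EE'(1,2) Q unfolding is_downset_def is_poset_def by (auto intro: finite_subset)
  ultimately have "card (E \<union> E') \<le> n + 1"
    using card_Un_Int[of E E'] by linarith
  with EE' show ?thesis
    using that by blast
qed

lemma subposet_subposet: "subposet (subposet Q W) E = subposet Q E"
  by (simp add: subposet_def)

lemma is_downset_subposet_iff:
  assumes "is_downset Q W"
  shows "is_downset (subposet Q W) E \<longleftrightarrow> is_downset Q E \<and> E \<subseteq> W"
  using assms unfolding is_downset_def subposet_def by auto

lemma is_witness_subposet: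
  assumes "is_witness n \<Gamma> Q" and W: "is_downset Q W"
    and "\<forall>P\<in>\<Gamma>. \<exists>E. is_downset Q E \<and> E \<subseteq> W \<and> card E = n \<and> poset_iso (subposet Q E) P"
  shows "is_witness n \<Gamma> (subposet Q W)"
  using assms unfolding is_witness_def subposet_subposet is_downset_subposet_iff[OF W] by blast

lemma minimal_witness_card_le:
  assumes min: "is_minimal_witness n \<Gamma> Q" and "finite \<Gamma>" and A: "is_downset Q A"
    and realised: "\<forall>P\<in>\<Delta>. \<exists>E. is_downset Q E \<and> E \<subseteq> A \<and> card E = n \<and> poset_iso (subposet Q E) P"
  shows "card (fst Q) \<le> card A + n * card (\<Gamma> - \<Delta>)"
proof -
  have wit: "is_witness n \<Gamma> Q"
    using min unfolding is_minimal_witness_def by blast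
  then have "\<forall>P\<in>\<Gamma> - \<Delta>. \<exists>E. is_downset Q E \<and> card E = n \<and> poset_iso (subposet Q E) P"
    unfolding is_witness_def by blast
  then obtain \<rho> where \<rho>: "\<forall>P\<in>\<Gamma> - \<Delta>. is_downset Q (\<rho> P) \<and> card (\<rho> P) = n \<and> poset_iso (subposet Q (\<rho> P)) P"
    by metis
  define W where "W = A \<union> (\<Union>P\<in>\<Gamma> - \<Delta>. \<rho> P)"
  have W: "is_downset Q W"
    unfolding W_def using A \<rho> by (simp add: is_downset_Un is_downset_UN)
  have "\<exists>E. is_downset Q E \<and> E \<subseteq> W \<and> card E = n \<and> poset_iso (subposet Q E) P"
    if "P \<in> \<Gamma>" for P
  proof (cases "P \<in> \<Delta>")
    case True
    with realised show ?thesis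
      unfolding W_def by blast
  next
    case False
    with that \<rho> show ?thesis
      unfolding W_def by blast
  qed
  then have "W = fst Q"
    using min is_witness_subposet[OF wit W] W unfolding is_minimal_witness_def by blast
  have "card W \<le> card A + card (\<Union>P\<in>\<Gamma> - \<Delta>. \<rho> P)"
    unfolding W_def by (rule card_Un_le)
  moreover have "card (\<Union>P\<in>\<Gamma> - \<Delta>. \<rho> P) \<le> (\<Sum>P\<in>\<Gamma> - \<Delta>. card (\<rho> P))"
    using \<open>finite \<Gamma>\<close> by (simp add: card_UN_le)
  moreover have "(\<Sum>P\<in>\<Gamma> - \<Delta>. card (\<rho> P)) = n * card (\<Gamma> - \<Delta>)"
    using \<rho> by simp
  ultimately have "card W \<le> card A + n * card (\<Gamma> - \<Delta>)"
    by linarith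
  with \<open>W = fst Q\<close> show ?thesis
    by simp
qed

theorem mainTheorem11:
  fixes \<Gamma> :: "nat poset set" and Q :: "'a poset" and n k :: nat
  assumes "finite \<Gamma>" and "card \<Gamma> = k" and "k \<ge> 2"
    and "\<forall>P\<in>\<Gamma>. is_poset P \<and> card (fst P) = n"
    and "\<forall>P\<in>\<Gamma>. \<forall>P'\<in>\<Gamma>. poset_iso P P' \<longrightarrow> P = P'"
    and "is_poset Q"
    and "is_minimal_witness n \<Gamma> Q"
  shows "card (fst Q) \<le> n * (k - 1) + 1"
proof -
  have wit: "is_witness n \<Gamma> Q"
    using assms(7) unfolding is_minimal_witness_def by blast
  obtain P1 P2 where P12: "P1 \<in> \<Gamma>" "P2 \<in> \<Gamma>" "P1 \<noteq> P2"
    using assms(1-3) card_le_Suc0_iff_eq[of \<Gamma>] by auto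
  then obtain R1 R2 where R1: "is_downset Q R1" "card R1 = n" "poset_iso (subposet Q R1) P1"
    and R2: "is_downset Q R2" "card R2 = n" "poset_iso (subposet Q R2) P2"
    using wit unfolding is_witness_def by meson
  then have "\<not> poset_iso (subposet Q R1) (subposet Q R2)"
    using poset_iso_iff_same_representative[OF assms(5)] P12 by blast
  then obtain D D' where D: "is_downset Q D" "card D = n" and D': "is_downset Q D'" "card D' = n"
    and noniso: "\<not> poset_iso (subposet Q D) (subposet Q D')" and close: "card (D \<union> D') \<le> n + 1"
    using exists_adjacent_nonisomorphic_downsets[OF assms(6) R1(1) R2(1) R1(2) R2(2)] by metis
  obtain P P' where P: "P \<in> \<Gamma>" "poset_iso (subposet Q D) P"
    and P': "P' \<in> \<Gamma>" "poset_iso (subposet Q D') P'"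
    using wit D D' unfolding is_witness_def by blast
  with noniso have "P \<noteq> P'"
    using poset_iso_iff_same_representative[OF assms(5)] by blast
  have "card (fst Q) \<le> card (D \<union> D') + n * card (\<Gamma> - {P, P'})"
    using D D' P P' by (intro minimal_witness_card_le[OF assms(7,1) is_downset_Un]) auto
  also have "card (\<Gamma> - {P, P'}) = k - 2"
    using assms(1,2) P P' \<open>P \<noteq> P'\<close> by (simp add: card_Diff_subset)
  finally have "card (fst Q) \<le> card (D \<union> D') + n * (k - 2)" .
  moreover have "n * (k - 1) = n + n * (k - 2)"
    using assms(3) by (cases k) (auto simp: algebra_simps)
  ultimately show ?thesis
    using close by linarith
qed

end
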